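(* Let $U\subset\mathbb{R}^n$ be open. If the functions $f_1,\dots,f_k:U\to\mathbb{R}$ are locally linear independent in $U$ and $U_i$, $i=1,\dots,k$, are arbitrary nonempty open subsets of $U$, then there exist $x_1,\dots,x_k$ with $x_i\in U_i$ for each $i$ such that $\mathrm{rank}(\{f_i(x_j)\}_{i,j=1}^k)=k$.
   Context: A collection of functions $f_s:U\to\mathbb{R}$ is locally linear independent in $U$ if for every nonempty open subset $W\subset U$: $\sum_s\alpha_sf_s(x)=0$ for (Lebesgue) almost every $x\in W$ if and only if $\alpha_s=0$ for all $s$. *)

theory Defs
  imports "HOL-Analysis.Analysis"
begin

text \<open>Only the restrictions of the total functions \<open>f s\<close> to \<open>U\<close> matter. No measurability of the
  \<open>f s\<close> is assumed: the almost-everywhere quantifier asks that the exceptional set be contained in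
  a Lebesgue null set.\<close>

definition locally_linear_independent ::
  "(real ^ 'n) set \<Rightarrow> ('s::finite \<Rightarrow> real ^ 'n \<Rightarrow> real) \<Rightarrow> bool"
  where "locally_linear_independent U f \<longleftrightarrow>
    (\<forall>W. open W \<and> W \<noteq> {} \<and> W \<subseteq> U \<longrightarrow>
      (\<forall>\<alpha>. (AE x in lebesgue. x \<in> W \<longrightarrow> (\<Sum>s\<in>UNIV. \<alpha> s * f s x) = 0) \<longleftrightarrow> (\<forall>s. \<alpha> s = 0)))"

end

theory Submission
  imports Defs
begin

text \<open>Put \<open>F x = (f\<^sub>1 x, \<dots>, f\<^sub>k x)\<close> and choose the points one at a time. As long as fewer than \<open>k\<close> points
  are chosen, some nonzero \<open>\<alpha>\<close> is orthogonal to the span of their images under \<open>F\<close>, and local linear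
  independence on the next open set yields a point \<open>y\<close> there with \<open>\<alpha> \<bullet> F y \<noteq> 0\<close>, whose image lies
  outside that span.\<close>

text \<open>A combination vanishing at every point of \<open>W\<close> would vanish there almost
  everywhere, forcing \<open>\<alpha> = 0\<close>.\<close>

lemma locally_linear_independent_obtains_nonzero:
  fixes f :: "'s::finite \<Rightarrow> real ^ 'n \<Rightarrow> real"
  assumes "locally_linear_independent U f" and "open W" "W \<noteq> {}" "W \<subseteq> U" and "\<alpha> \<noteq> 0"
  obtains y where "y \<in> W" "\<alpha> \<bullet> (\<chi> s. f s y) \<noteq> 0"
proof -
  have "\<exists>s. \<alpha> $ s \<noteq> 0"
    using \<open>\<alpha> \<noteq> 0\<close> by (simp add: vec_eq_iff)
  then have "\<not> (AE x in lebesgue. x \<in> W \<longrightarrow> (\<Sum>s\<in>UNIV. \<alpha> $ s * f s x) = 0)"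
    using assms(1-4) unfolding locally_linear_independent_def by blast
  then obtain y where "y \<in> W" "(\<Sum>s\<in>UNIV. \<alpha> $ s * f s y) \<noteq> 0"
    by (metis (mono_tags, lifting) AE_I2)
  then show thesis
    using that by (simp add: inner_vec_def)
qed

text \<open>The finite index set \<open>A\<close> is kept general for the induction. Injectivity is
  carried along because independence of the image, as a set, does not rule out repeated
  values.\<close>

lemma locally_linear_independent_imp_independent_values:
  fixes f :: "'s::finite \<Rightarrow> real ^ 'n \<Rightarrow> real" and V :: "'i \<Rightarrow> (real ^ 'n) set"
  assumes "locally_linear_independent U f"
    and "\<And>i. open (V i)" "\<And>i. V i \<noteq> {}" "\<And>i. V i \<subseteq> U"
    and "finite A" "card A \<le> CARD('s)"
  shows "\<exists>x. (\<forall>i\<in>A. x i \<in> V i) \<and> inj_on (\<lambda>i. (\<chi> s. f s (x i)) :: real ^ 's) A \<and>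
    independent ((\<lambda>i. \<chi> s. f s (x i)) ` A)"
  using \<open>finite A\<close> \<open>card A \<le> CARD('s)\<close>
proof induction
  case empty
  then show ?case
    by (simp add: independent_empty)
next
  case (insert a A)
  define F where "F y = ((\<chi> s. f s y) :: real ^ 's)" for y
  obtain x where x: "\<forall>i\<in>A. x i \<in> V i" "inj_on (F \<circ> x) A" "independent ((F \<circ> x) ` A)"
    using insert unfolding F_def comp_def by auto
  have "dim ((F \<circ> x) ` A) \<le> card A"
    using insert.hyps by (meson card_image_le dim_le_card' finite_imageI le_trans)
  \<comment> \<open>Strict because \<open>a\<close> is not in \<open>A\<close>, so
    \<open>card A + 1 \<le> CARD('s)\<close>.\<close>
  then have "dim ((F \<circ> x) ` A) < DIM(real ^ 's)"
    using insert by simp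
  then obtain \<alpha> where \<alpha>: "\<alpha> \<noteq> 0" "\<And>v. v \<in> span ((F \<circ> x) ` A) \<Longrightarrow> orthogonal \<alpha> v"
    using orthogonal_to_subspace_exists by blast
  obtain y where y: "y \<in> V a" "\<alpha> \<bullet> F y \<noteq> 0"
    using locally_linear_independent_obtains_nonzero[OF assms(1-4) \<alpha>(1)] unfolding F_def by blast
  \<comment> \<open>Everything in the span is orthogonal to \<open>\<alpha>\<close>, whereas
    \<open>F y\<close> is not.\<close>
  have notin: "F y \<notin> span ((F \<circ> x) ` A)"
    using \<alpha>(2) y(2) by (auto simp: orthogonal_def)
  define x' where "x' = x(a := y)"
  have eq: "(F \<circ> x') i = (F \<circ> x) i" if "i \<in> A" for i
    using that insert.hyps by (auto simp: x'_def)
  then have img: "(F \<circ> x') ` A = (F \<circ> x) ` A"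
    by simp
  have a: "(F \<circ> x') a = F y"
    by (simp add: x'_def)
  have "inj_on (F \<circ> x') A"
    using x(2) by (simp only: inj_on_cong[of A "F \<circ> x'" "F \<circ> x", OF eq])
  moreover have "F y \<notin> (F \<circ> x) ` A"
    by (rule contra_subsetD[OF span_superset notin])
  ultimately have "inj_on (F \<circ> x') (insert a A)"
    using insert.hyps(2) unfolding inj_on_insert a by (simp only: Diff_insert0 Diff_empty img simp_thms)
  moreover have "independent ((F \<circ> x') ` insert a A)"
    using notin x(3) unfolding image_insert img a by (rule independent_insertI)
  moreover have "\<forall>i\<in>insert a A. x' i \<in> V i"
    using x(1) y(1) by (simp add: x'_def)
  ultimately show ?case
    unfolding F_def comp_def by blast
qed

theorem lemma5:
  fixes U :: "(real ^ 'n) set"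
    and f :: "'k::finite \<Rightarrow> real ^ 'n \<Rightarrow> real"
    and V :: "'k \<Rightarrow> (real ^ 'n) set"
  assumes "open U"
    and "locally_linear_independent U f"
    and "\<And>i. open (V i)" and "\<And>i. V i \<noteq> {}" and "\<And>i. V i \<subseteq> U"
  shows "\<exists>x :: 'k \<Rightarrow> real ^ 'n. (\<forall>i. x i \<in> V i) \<and>
    rank ((\<chi> i j. f i (x j)) :: real ^ 'k ^ 'k) = CARD('k)"
proof -
  obtain x :: "'k \<Rightarrow> real ^ 'n" where x: "\<forall>i. x i \<in> V i"
    and inj: "inj (\<lambda>j. (\<chi> i. f i (x j)) :: real ^ 'k)"
    and indep: "independent (range (\<lambda>j. (\<chi> i. f i (x j)) :: real ^ 'k))"
    using locally_linear_independent_imp_independent_values[OF assms(2), of V UNIV] assms(3-5) by auto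
  have "columns ((\<chi> i j. f i (x j)) :: real ^ 'k ^ 'k) = range (\<lambda>j. \<chi> i. f i (x j))"
    by (auto simp: columns_def column_def)
  \<comment> \<open>The rank is the dimension of the set of columns. Independence makes this the
    number of distinct columns, and \<open>inj\<close> makes that number
    \<open>CARD('k)\<close>.\<close>
  then have "rank ((\<chi> i j. f i (x j)) :: real ^ 'k ^ 'k) = CARD('k)"
    using indep inj by (simp add: column_rank_def dim_eq_card_independent card_image)
  with x show ?thesis
    by blast
qed

end
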